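(* Let $S$ be a finite set with $n=|S|\ge1$, let $B\subseteq\mathbb{R}^S$ be an integral base-polyhedron, and let $k$ be an integer with $1\le k\le n$. Then every decreasingly minimal element $m$ of $B\cap\mathbb{Z}^S$ minimizes, over all $y\in B\cap\mathbb{Z}^S$, the sum of the $k$ largest components of $y$.
   Context: An integral base-polyhedron is a set of the form $B=\{x\in\mathbb{R}^S:\widetilde x(S)=b(S),\ \widetilde x(Z)\le b(Z)\ \forall Z\subseteq S\}$ where $b$ is an integer-valued submodular set-function ($+\infty$ values allowed) with $b(\emptyset)=0$ and $b(S)$ finite; here $\widetilde x(Z)=\sum_{s\in Z}x(s)$. For a vector $x$, $x{\downarrow}$ is the vector with its components rearranged in decreasing order; $m\in Q$ is decreasingly minimal in $Q$ if $m{\downarrow}$ is lexicographically smaller than or equal to $y{\downarrow}$ for all $y\in Q$. *)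

theory Defs
  imports "HOL-Analysis.Analysis"
begin

definition vec_sum :: "real ^ 's::finite \<Rightarrow> 's set \<Rightarrow> real" where
  "vec_sum x Z = (\<Sum>s\<in>Z. x $ s)"

text \<open>Values are integers or \<open>+\<infinity>\<close>; the value \<open>-\<infinity>\<close> is excluded, so sums of values of
  an integer-valued set-function are always meaningful in \<^typ>\<open>ereal\<close>.\<close>

definition integer_valued :: "('s set \<Rightarrow> ereal) \<Rightarrow> bool" where
  "integer_valued b \<longleftrightarrow> (\<forall>Z. b Z = \<infinity> \<or> (\<exists>i::int. b Z = ereal (of_int i)))"

definition submodular :: "('s set \<Rightarrow> ereal) \<Rightarrow> bool" where
  "submodular b \<longleftrightarrow> (\<forall>X Y. b X + b Y \<ge> b (X \<inter> Y) + b (X \<union> Y))"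

definition base_polyhedron :: "('s::finite set \<Rightarrow> ereal) \<Rightarrow> (real ^ 's) set" where
  "base_polyhedron b =
     {x. ereal (vec_sum x UNIV) = b UNIV \<and> (\<forall>Z. ereal (vec_sum x Z) \<le> b Z)}"

definition integral_base_polyhedron :: "(real ^ 's::finite) set \<Rightarrow> bool" where
  "integral_base_polyhedron B \<longleftrightarrow>
     (\<exists>b. integer_valued b \<and> submodular b \<and> b {} = 0 \<and> \<bar>b UNIV\<bar> \<noteq> \<infinity> \<and> B = base_polyhedron b)"

definition integer_vectors :: "(real ^ 's::finite) set" where
  "integer_vectors = {x. \<forall>s. x $ s \<in> \<int>}"

definition decreasing_rearrangement :: "real ^ 's::finite \<Rightarrow> real list" where
  "decreasing_rearrangement x =
     rev (sorted_list_of_multiset (image_mset (\<lambda>s. x $ s) (mset_set UNIV)))"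

text \<open>Both lists have length \<^term>\<open>CARD('s)\<close>, so the clause of \<^const>\<open>ord_class.lexordp_eq\<close>
  for proper prefixes plays no role.\<close>

definition decreasingly_minimal :: "(real ^ 's::finite) set \<Rightarrow> real ^ 's \<Rightarrow> bool" where
  "decreasingly_minimal Q m \<longleftrightarrow> m \<in> Q \<and>
     (\<forall>y\<in>Q. ord_class.lexordp_eq (decreasing_rearrangement m) (decreasing_rearrangement y))"

definition sum_largest :: "nat \<Rightarrow> real ^ 's::finite \<Rightarrow> real" where
  "sum_largest k x = sum_list (take k (decreasing_rearrangement x))"

end

theory Submission
  imports Defs
begin

text \<open>
  The sum of the \<open>k\<close> largest components of \<open>x\<close> is the minimum over \<open>a\<close> of
  \<open>k a + (\<Sum>s. (x s - a)\<^sup>+)\<close>, attained when \<open>a\<close> is the \<open>k\<close>-th largest component. So it suffices that a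
  decreasingly minimal \<open>m\<close> minimizes \<open>\<Sum>s. (y s - a)\<^sup>+\<close> for every integer \<open>a\<close>.
  If \<open>m s < a < m t\<close>, then moving a unit from \<open>t\<close> to \<open>s\<close> would make \<open>m\<close> decreasingly smaller, so
  some \<open>m\<close>-tight set contains \<open>s\<close> but not \<open>t\<close>. Tight sets form a lattice, so there is a tight set
  \<open>L\<close> with \<open>m \<le> a\<close> on \<open>L\<close> and \<open>m \<ge> a\<close> on its complement \<open>H\<close>, and
  \<open>(\<Sum>s. (m s - a)\<^sup>+) = m(H) - a |H| \<le> y(H) - a |H| \<le> (\<Sum>s. (y s - a)\<^sup>+)\<close> for every \<open>y \<in> B\<close>,
  the first inequality because \<open>m(L) = b(L) \<ge> y(L)\<close> and \<open>m(S) = y(S)\<close>.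
\<close>

section \<open>Decreasing rearrangements\<close>

lemma mset_decreasing_rearrangement:
  "mset (decreasing_rearrangement x) = image_mset (\<lambda>s. x $ s) (mset_set UNIV)"
  by (simp add: decreasing_rearrangement_def)

lemma sorted_decreasing_rearrangement:
  "sorted_wrt (\<ge>) (decreasing_rearrangement x)"
  by (simp add: decreasing_rearrangement_def sorted_wrt_rev)

lemma length_decreasing_rearrangement:
  fixes x :: "real ^ 's::finite"
  shows "length (decreasing_rearrangement x) = CARD('s)"
  by (metis mset_decreasing_rearrangement size_image_mset size_mset size_mset_set)

lemma set_decreasing_rearrangement: "set (decreasing_rearrangement x) = range (\<lambda>s. x $ s)"
  by (metis finite finite_set_mset_mset_set mset_decreasing_rearrangement set_image_mset set_mset_mset)

lemma sum_list_decreasing_rearrangement: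
  "(\<Sum>v\<leftarrow>decreasing_rearrangement x. f v) = (\<Sum>s\<in>UNIV. f (x $ s))"
proof -
  have "(\<Sum>v\<leftarrow>decreasing_rearrangement x. f v)
      = sum_mset (image_mset f (mset (decreasing_rearrangement x)))"
    by (metis mset_map sum_mset_sum_list)
  then show ?thesis
    by (simp add: mset_decreasing_rearrangement image_mset.compositionality comp_def sum_unfold_sum_mset)
qed

lemma count_decreasing_rearrangement:
  "count_list (decreasing_rearrangement x) v = card {s. x $ s = v}"
proof -
  have "count_list (decreasing_rearrangement x) v
      = count (image_mset (\<lambda>s. x $ s) (mset_set UNIV)) v"
    by (metis count_mset mset_decreasing_rearrangement)
  also have "\<dots> = card {s. x $ s = v}"
    by (simp add: count_image_mset' sum.If_cases Collect_conj_eq eq_commute)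
  finally show ?thesis .
qed

text \<open>Both lists begin with the same block of entries above \<open>v\<close>. After it
  \<open>xs\<close> has more copies of \<open>v\<close>, so at the first difference
  \<open>ys\<close> has a smaller entry or has ended.\<close>

lemma not_lexordp_eq_if_count_list_less:
  fixes xs ys :: "'a::linorder list"
  assumes "sorted_wrt (\<ge>) xs" "sorted_wrt (\<ge>) ys"
    and "\<And>w. v < w \<Longrightarrow> count_list xs w = count_list ys w"
    and "count_list ys v < count_list xs v"
  shows "\<not> ord_class.lexordp_eq xs ys"
  using assms
proof (induction xs arbitrary: ys)
  case Nil
  then show ?case by simp
next
  case (Cons x xs)
  show ?case
  proof (cases ys)
    case Nil
    then show ?thesis by simp
  next
    case ys: (Cons y zs)
    \<comment> \<open>The head is the maximum, so \<open>v\<close> is at most \<open>x\<close>; a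
      head \<open>y\<close> above \<open>x\<close> would then fall under the hypothesis of equal
      counts.\<close>
    have "v \<in> set (x # xs)"
      using Cons.prems(4) by (metis count_list_0_iff not_less0)
    then have "v \<le> x"
      using Cons.prems(1) by auto
    have "\<not> x < y"
    proof
      assume "x < y"
      then have "count_list (x # xs) y = count_list (y # zs) y"
        using Cons.prems(3) \<open>v \<le> x\<close> ys by auto
      then have "y \<in> set (x # xs)"
        by (metis count_list_0_iff list.set_intros(1))
      then show False
        using Cons.prems(1) \<open>x < y\<close> by auto
    qed
    moreover have "\<not> ord_class.lexordp_eq xs zs" if "x = y"
    proof (rule Cons.IH)
      show "count_list xs w = count_list zs w" if "v < w" for w
        using Cons.prems(3)[OF that] ys \<open>x = y\<close> by (auto split: if_splits)
    qed (use Cons.prems ys that in \<open>auto split: if_splits\<close>)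
    ultimately show ?thesis
      using ys by auto
  qed
qed

section \<open>Sums of largest entries as minima over thresholds\<close>

lemma sum_list_take_le:
  fixes xs :: "real list"
  assumes "k \<le> length xs"
  shows "sum_list (take k xs) \<le> k * a + (\<Sum>x\<leftarrow>xs. max (x - a) 0)"
  using assms
proof (induction xs arbitrary: k)
  case Nil
  then show ?case by simp
next
  case (Cons x xs)
  show ?case
  proof (cases k)
    case 0
    then show ?thesis by (auto intro!: add_nonneg_nonneg sum_list_nonneg)
  next
    case (Suc j)
    then show ?thesis using Cons.IH[of j] Cons.prems by (auto simp: algebra_simps)
  qed
qed

text \<open>Entries up to index \<open>j\<close> are at least \<open>xs ! j\<close>, so each equals
  \<open>xs ! j\<close> plus its positive part; later entries have positive part zero.\<close>

lemma sum_list_take_eq: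
  fixes xs :: "real list"
  assumes "sorted_wrt (\<ge>) xs" and "j < length xs"
  shows "sum_list (take (Suc j) xs) = Suc j * (xs ! j) + (\<Sum>x\<leftarrow>xs. max (x - xs ! j) 0)"
  using assms
proof (induction xs arbitrary: j)
  case Nil
  then show ?case by simp
next
  case (Cons x xs)
  show ?case
  proof (cases j)
    case 0
    have "(\<Sum>y\<leftarrow>xs. max (y - x) 0) = (\<Sum>y\<leftarrow>xs. 0)"
      using Cons.prems by (intro arg_cong[where f = sum_list] map_cong) auto
    then show ?thesis using 0 by simp
  next
    case (Suc i)
    then show ?thesis using Cons.IH[of i] Cons.prems by (auto simp: algebra_simps)
  qed
qed

lemma sum_largest_le:
  fixes x :: "real ^ 's::finite"
  assumes "k \<le> CARD('s)"
  shows "sum_largest k x \<le> k * a + (\<Sum>s\<in>UNIV. max (x $ s - a) 0)"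
  using sum_list_take_le[of k "decreasing_rearrangement x" a] assms
  unfolding sum_largest_def sum_list_decreasing_rearrangement
  by (simp add: length_decreasing_rearrangement)

text \<open>The threshold is the \<open>k\<close>-th largest entry. Giving it as a component of
  \<open>x\<close> makes it an integer whenever \<open>x\<close> is an integer vector.\<close>

lemma sum_largest_eq:
  fixes x :: "real ^ 's::finite"
  assumes "1 \<le> k" and "k \<le> CARD('s)"
  obtains t where "sum_largest k x = k * x $ t + (\<Sum>s\<in>UNIV. max (x $ s - x $ t) 0)"
proof -
  let ?xs = "decreasing_rearrangement x"
  obtain j where k: "k = Suc j" using assms(1) by (cases k) auto
  have j: "j < length ?xs"
    using assms k by (simp add: length_decreasing_rearrangement)
  obtain t where t: "?xs ! j = x $ t"
    using nth_mem[OF j] by (auto simp: set_decreasing_rearrangement)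
  show thesis
    using that[of t] sum_list_take_eq[OF sorted_decreasing_rearrangement j]
    unfolding t k sum_largest_def sum_list_decreasing_rearrangement by simp
qed

section \<open>Unit transfers and tight sets\<close>

text \<open>The gap keeps both new components below \<open>x $ t\<close>, so larger values are
  undisturbed and one component fewer equals \<open>x $ t\<close>.\<close>

lemma unit_transfer_not_lexordp_eq:
  fixes x :: "real ^ 's::finite"
  assumes "x $ s + 1 < x $ t"
  shows "\<not> ord_class.lexordp_eq (decreasing_rearrangement x)
            (decreasing_rearrangement (x + axis s 1 - axis t 1))"
    (is "\<not> ord_class.lexordp_eq _ (decreasing_rearrangement ?x')")
proof (rule not_lexordp_eq_if_count_list_less[where v = "x $ t"])
  have "s \<noteq> t" using assms by auto
  then have x': "?x' $ u = (if u = s then x $ s + 1 else if u = t then x $ t - 1 else x $ u)" for u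
    by (simp add: axis_def)
  show "count_list (decreasing_rearrangement x) w = count_list (decreasing_rearrangement ?x') w"
    if "x $ t < w" for w
  proof -
    have "{u. x $ u = w} = {u. ?x' $ u = w}"
      using that assms unfolding x' by auto
    then show ?thesis by (simp only: count_decreasing_rearrangement)
  qed
  have "{u. ?x' $ u = x $ t} \<subset> {u. x $ u = x $ t}"
    using assms unfolding x' by auto
  then show "count_list (decreasing_rearrangement ?x') (x $ t)
      < count_list (decreasing_rearrangement x) (x $ t)"
    by (simp only: count_decreasing_rearrangement psubset_card_mono finite)
qed (rule sorted_decreasing_rearrangement)+

definition tight :: "('s::finite set \<Rightarrow> ereal) \<Rightarrow> real ^ 's \<Rightarrow> 's set \<Rightarrow> bool" where
  "tight b x Z \<longleftrightarrow> b Z = ereal (vec_sum x Z)"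

lemma vec_sum_Un_Int: "vec_sum x (X \<inter> Y) + vec_sum x (X \<union> Y) = vec_sum x X + vec_sum x Y"
  using sum.union_inter[of X Y "\<lambda>s. x $ s"] by (simp add: vec_sum_def add.commute)

text \<open>Since \<open>vec_sum x\<close> is modular, submodularity bounds the sum of the two
  values of \<open>b\<close> by the sum of their lower bounds, so neither bound is slack.\<close>

lemma tight_Int_Un:
  assumes "submodular b" and "x \<in> base_polyhedron b" and "tight b x X" and "tight b x Y"
  shows "tight b x (X \<inter> Y)" and "tight b x (X \<union> Y)"
proof -
  have sub: "b (X \<inter> Y) + b (X \<union> Y) \<le> ereal (vec_sum x (X \<inter> Y) + vec_sum x (X \<union> Y))"
    using assms by (metis submodular_def tight_def vec_sum_Un_Int plus_ereal.simps(1))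
  have le: "ereal (vec_sum x (X \<inter> Y)) \<le> b (X \<inter> Y)" "ereal (vec_sum x (X \<union> Y)) \<le> b (X \<union> Y)"
    using assms(2) by (auto simp: base_polyhedron_def)
  show "tight b x (X \<inter> Y)" "tight b x (X \<union> Y)"
    using sub le unfolding tight_def
    by (cases "b (X \<inter> Y)"; cases "b (X \<union> Y)"; simp)+
qed

lemma tight_INT:
  assumes "submodular b" and "x \<in> base_polyhedron b" and "\<And>i. i \<in> I \<Longrightarrow> tight b x (A i)"
    and "finite I"
  shows "tight b x (\<Inter>i\<in>I. A i)"
  using assms(4,3)
proof (induction I rule: finite_induct)
  case empty
  \<comment> \<open>The empty intersection is \<open>UNIV\<close>; this case arises when no
    component exceeds the threshold.\<close>
  then show ?case using assms(2) by (simp add: base_polyhedron_def tight_def)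
next
  case (insert i I)
  then show ?case using tight_Int_Un(1)[OF assms(1,2)] by simp
qed

lemma tight_UN:
  assumes "submodular b" and "x \<in> base_polyhedron b" and "\<And>i. i \<in> I \<Longrightarrow> tight b x (A i)"
    and "finite I" and "b {} = 0"
  shows "tight b x (\<Union>i\<in>I. A i)"
  using assms(4,3)
proof (induction I rule: finite_induct)
  case empty
  then show ?case using assms(5) by (simp add: vec_sum_def tight_def zero_ereal_def)
next
  case (insert i I)
  then show ?case using tight_Int_Un(2)[OF assms(1,2)] by simp
qed

text \<open>A constraint that becomes violated must gain 1 from the transfer, which forces
  \<open>s\<close> in and \<open>t\<close> out of \<open>Z\<close>. Both sides being integers, it
  held with equality before.\<close>

lemma unit_transfer_notin_obtains_tight:
  assumes "integer_valued b" and "x \<in> base_polyhedron b" and "x \<in> integer_vectors"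
    and "x + axis s 1 - axis t 1 \<notin> base_polyhedron b"
  obtains Z where "tight b x Z" and "s \<in> Z" and "t \<notin> Z"
proof -
  let ?x' = "x + axis s 1 - axis t 1"
  have sum': "vec_sum ?x' Z = vec_sum x Z + of_bool (s \<in> Z) - of_bool (t \<in> Z)" for Z
    by (simp add: vec_sum_def axis_def sum.distrib sum_subtractf)
  then have "ereal (vec_sum ?x' UNIV) = b UNIV"
    using assms(2) by (simp add: base_polyhedron_def)
  then obtain Z where Z: "\<not> ereal (vec_sum ?x' Z) \<le> b Z"
    using assms(4) by (auto simp: base_polyhedron_def)
  have le: "ereal (vec_sum x Z) \<le> b Z"
    using assms(2) by (simp add: base_polyhedron_def)
  obtain i :: int where i: "b Z = ereal (of_int i)"
    using Z assms(1) unfolding integer_valued_def by (metis ereal_less_eq(1))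
  have "vec_sum x Z \<in> \<int>"
    using assms(3) by (auto simp: vec_sum_def integer_vectors_def)
  then obtain j :: int where j: "vec_sum x Z = of_int j" by (auto elim: Ints_cases)
  have st: "s \<in> Z \<and> t \<notin> Z"
    using Z le unfolding i sum' by (auto simp: of_bool_def split: if_splits)
  then have "i < j + 1" using Z unfolding i sum' j by simp
  moreover have "j \<le> i" using le i j by simp
  ultimately have "tight b x Z" by (simp add: tight_def i j)
  then show thesis using that st by blast
qed

section \<open>Minimality of the total excess over an integer threshold\<close>

lemma decreasingly_minimal_sum_excess_le:
  fixes m y :: "real ^ 's::finite"
  assumes b: "integer_valued b" "submodular b" "b {} = 0"
    and m: "decreasingly_minimal (base_polyhedron b \<inter> integer_vectors) m"
    and y: "y \<in> base_polyhedron b" and a: "a \<in> \<int>"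
  shows "(\<Sum>s\<in>UNIV. max (m $ s - a) 0) \<le> (\<Sum>s\<in>UNIV. max (y $ s - a) 0)"
proof -
  have mB: "m \<in> base_polyhedron b" and mI: "m \<in> integer_vectors"
    using m by (auto simp: decreasingly_minimal_def)
  have "\<exists>Z. tight b m Z \<and> s \<in> Z \<and> t \<notin> Z" if "m $ s < a" "a < m $ t" for s t
  proof -
    have "m $ s \<in> \<int>" "m $ t \<in> \<int>" using mI by (auto simp: integer_vectors_def)
    \<comment> \<open>Integrality of \<open>a\<close> enters here: \<open>m $ s + 1\<close> is at
      most \<open>a\<close>.\<close>
    then have "m $ s + 1 < m $ t"
      using that a by (auto elim!: Ints_cases)
    moreover have "m + axis s 1 - axis t 1 \<in> integer_vectors"
      using mI by (auto simp: integer_vectors_def axis_def)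
    ultimately have "m + axis s 1 - axis t 1 \<notin> base_polyhedron b"
      using m unit_transfer_not_lexordp_eq by (fastforce simp: decreasingly_minimal_def)
    then show ?thesis
      using unit_transfer_notin_obtains_tight[OF b(1) mB mI] by metis
  qed
  then obtain Z where Z: "\<And>s t. m $ s < a \<Longrightarrow> a < m $ t \<Longrightarrow> tight b m (Z s t) \<and> s \<in> Z s t \<and> t \<notin> Z s t"
    by metis
  \<comment> \<open>Each intersection contains its \<open>s\<close> and avoids every
    \<open>t\<close> above the threshold; the union then gathers all \<open>s\<close> below it and
    still avoids every such \<open>t\<close>.\<close>
  define L where "L = (\<Union>s\<in>{s. m $ s < a}. \<Inter>t\<in>{t. a < m $ t}. Z s t)"
  have "tight b m L"
    unfolding L_def using Z b mB by (intro tight_UN tight_INT) auto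
  have L_low: "m $ u \<le> a" if "u \<in> L" for u
    using that Z unfolding L_def by force
  have L_high: "a \<le> m $ u" if "u \<notin> L" for u
    using that Z unfolding L_def by force
  have compl: "vec_sum x (- L) = vec_sum x UNIV - vec_sum x L" for x :: "real ^ 's"
    using sum_diff[of UNIV L "\<lambda>s. x $ s"] by (simp add: vec_sum_def Compl_eq_Diff_UNIV)
  have "ereal (vec_sum y L) \<le> ereal (vec_sum m L)"
    using y \<open>tight b m L\<close> unfolding tight_def base_polyhedron_def by (metis (mono_tags, lifting) mem_Collect_eq)
  moreover have "ereal (vec_sum y UNIV) = ereal (vec_sum m UNIV)"
    using y mB by (simp add: base_polyhedron_def)
  ultimately have "vec_sum m (- L) \<le> vec_sum y (- L)"
    by (simp add: compl)
  moreover have "(\<Sum>s\<in>UNIV. max (m $ s - a) 0) = (\<Sum>s\<in>- L. m $ s - a)"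
    using L_low L_high by (intro sum.mono_neutral_cong_right) (force simp: max_def)+
  moreover have "(\<Sum>s\<in>- L. y $ s - a) \<le> (\<Sum>s\<in>- L. max (y $ s - a) 0)"
    by (intro sum_mono) simp
  moreover have "(\<Sum>s\<in>- L. max (y $ s - a) 0) \<le> (\<Sum>s\<in>UNIV. max (y $ s - a) 0)"
    by (intro sum_mono2) auto
  ultimately show ?thesis
    by (simp add: vec_sum_def sum_subtractf)
qed

theorem theorem3p5:
  fixes B :: "(real ^ 's::finite) set" and m :: "real ^ 's" and k :: nat
  assumes "integral_base_polyhedron B"
    and "1 \<le> k" and "k \<le> CARD('s)"
    and "decreasingly_minimal (B \<inter> integer_vectors) m"
  shows "\<forall>y \<in> B \<inter> integer_vectors. sum_largest k m \<le> sum_largest k y"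
proof
  fix y assume y: "y \<in> B \<inter> integer_vectors"
  obtain b where b: "integer_valued b" "submodular b" "b {} = 0" "B = base_polyhedron b"
    using assms(1) by (auto simp: integral_base_polyhedron_def)
  \<comment> \<open>The threshold comes from \<open>y\<close>, not from \<open>m\<close>: the
    formula must be exact for \<open>y\<close>, while for \<open>m\<close> an upper bound
    suffices.\<close>
  obtain t where t: "sum_largest k y = k * y $ t + (\<Sum>s\<in>UNIV. max (y $ s - y $ t) 0)"
    using sum_largest_eq assms(2,3) by blast
  have "sum_largest k m \<le> k * y $ t + (\<Sum>s\<in>UNIV. max (m $ s - y $ t) 0)"
    using assms(3) by (rule sum_largest_le)
  moreover have "(\<Sum>s\<in>UNIV. max (m $ s - y $ t) 0) \<le> (\<Sum>s\<in>UNIV. max (y $ s - y $ t) 0)"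
    using y assms(4) b(4)
    by (intro decreasingly_minimal_sum_excess_le[OF b(1-3)]) (auto simp: integer_vectors_def)
  ultimately show "sum_largest k m \<le> sum_largest k y"
    using t by simp
qed

end
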